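(* Let $S^3=\{(z,w)\in\mathbb{C}^2 : |z|^2+|w|^2=1\}$, let $g:\mathbb{C}^2\to\mathbb{C}$ be a function of class at least $\mathcal{C}^2$ (in the real sense), and let $G:S^3\hookrightarrow\mathbb{C}^3$, $G(z,w)=(z,w,g(z,w))$, be the corresponding graphical embedding. Let $$\mathcal{L}=z\frac{\partial}{\partial\overline{w}}-w\frac{\partial}{\partial\overline{z}},\qquad \overline{\mathcal{L}}=\overline{z}\frac{\partial}{\partial w}-\overline{w}\frac{\partial}{\partial z}.$$ Then at any complex tangent $(z,w)\in S^3$ of the embedding, the Bishop invariant is given by $$\gamma_g(z,w)=\frac12\,\frac{|\mathcal{L}(\mathcal{L}(g))(z,w)|}{|\overline{\mathcal{L}}(\mathcal{L}(g))(z,w)|}\in[0,\infty],$$ where the complex tangent is degenerate if both the numerator $\mathcal{L}(\mathcal{L}(g))(z,w)$ and the denominator $\overline{\mathcal{L}}(\mathcal{L}(g))(z,w)$ are zero (and the quotient is read as $\infty$ if only the denominator is zero).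
   Context: Coordinates on $\mathbb{C}^3$ are $(z,w,\zeta)$; $\partial/\partial z,\partial/\partial\overline z$, etc. are Wirtinger derivatives. The image of the graphical embedding is $\mathcal{S}=\{(z,w,\zeta): |z|^2+|w|^2=1,\ \zeta=g(z,w)\}=\{r_1=r_2=r_3=0\}$ with real defining functions $r_1=\mathrm{Re}(\zeta-g(z,w))$, $r_2=\mathrm{Im}(\zeta-g(z,w))$, $r_3=|z|^2+|w|^2-1$. A point $m\in\mathcal{S}$ (identified with the corresponding point $(z,w)\in S^3$) is a complex tangent if $T_m\mathcal{S}\cap J(T_m\mathcal{S})$ is a complex line, where $J$ is the complex structure of $\mathbb{C}^3$. Define $B=\det\left(\frac{\partial(r_1,r_2,r_3)}{\partial(z,w,\zeta)}\right)$, i.e. $\partial r_1\wedge\partial r_2\wedge\partial r_3=B\,dz\wedge dw\wedge d\zeta$; then $m\in\mathcal{S}$ is a complex tangent if and only if $B(m)=0$. At a complex tangent $m$, let $X=\xi_1\frac{\partial}{\partial z}+\xi_2\frac{\partial}{\partial w}+\xi_3\frac{\partial}{\partial\zeta}$ be a nonzero $(1,0)$ vector at $m$ with $X(r_1)=X(r_2)=X(r_3)=0$ (unique up to a nonzero complex factor), and let $\overline{X}$ be its conjugate. The complex tangent $m$ is non-degenerate if $XB(m)\neq0$ or $\overline{X}B(m)\neq0$, and degenerate otherwise. At a non-degenerate complex tangent the Bishop invariant is $$\gamma(m)=\frac12\left|\frac{XB(m)}{\overline{X}B(m)}\right|\in[0,\infty],$$ with value $\infty$ when $\overline{X}B(m)=0$.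 One writes $\gamma_g$ for the Bishop invariant of the embedding given by $g$. *)

theory Defs
  imports "HOL-Analysis.Analysis"
begin

definition C2 :: "('a::real_normed_vector \<Rightarrow> 'b::real_normed_vector) \<Rightarrow> bool" where
  "C2 f \<longleftrightarrow> (\<exists>(f' :: 'a \<Rightarrow> 'a \<Rightarrow>\<^sub>L 'b) (f'' :: 'a \<Rightarrow> 'a \<Rightarrow>\<^sub>L 'a \<Rightarrow>\<^sub>L 'b).
     (\<forall>x. (f has_derivative blinfun_apply (f' x)) (at x)) \<and>
     (\<forall>x. (f' has_derivative blinfun_apply (f'' x)) (at x)) \<and>
     continuous_on UNIV f'')"

text \<open>
  Wirtinger derivatives in the \<open>k\<close>-th coordinate \<open>z\<^sub>k = x\<^sub>k + \<i> y\<^sub>k\<close>. The Frechet derivative is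
  the real one: \<open>axis k 1\<close> is the direction of \<open>x\<^sub>k\<close> and \<open>axis k \<i>\<close> that of \<open>y\<^sub>k\<close>.
\<close>

definition wirtinger :: "'n::finite \<Rightarrow> (complex^'n \<Rightarrow> complex) \<Rightarrow> complex^'n \<Rightarrow> complex" where
  "wirtinger k f p =
     (frechet_derivative f (at p) (axis k 1) - \<i> * frechet_derivative f (at p) (axis k \<i>)) / 2"

definition wirtinger_bar :: "'n::finite \<Rightarrow> (complex^'n \<Rightarrow> complex) \<Rightarrow> complex^'n \<Rightarrow> complex" where
  "wirtinger_bar k f p =
     (frechet_derivative f (at p) (axis k 1) + \<i> * frechet_derivative f (at p) (axis k \<i>)) / 2"

text \<open>
  A vector \<open>\<xi>\<close> stands for the (1,0) vector \<open>X = \<Sum>\<^sub>k \<xi>\<^sub>k \<partial>/\<partial>z\<^sub>k\<close>; the two definitions are the action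
  of \<open>X\<close> and of its conjugate on a function, at the point \<open>p\<close>.
\<close>

definition vec_10 :: "complex^'n::finite \<Rightarrow> (complex^'n \<Rightarrow> complex) \<Rightarrow> complex^'n \<Rightarrow> complex" where
  "vec_10 \<xi> f p = (\<Sum>k\<in>UNIV. \<xi> $ k * wirtinger k f p)"

definition vec_01 :: "complex^'n::finite \<Rightarrow> (complex^'n \<Rightarrow> complex) \<Rightarrow> complex^'n \<Rightarrow> complex" where
  "vec_01 \<xi> f p = (\<Sum>k\<in>UNIV. cnj (\<xi> $ k) * wirtinger_bar k f p)"

text \<open>
  Points of \<open>\<complex>\<^sup>2\<close> and \<open>\<complex>\<^sup>3\<close> have coordinates \<open>(z, w) = (q $ 1, q $ 2)\<close> and
  \<open>(z, w, \<zeta>) = (p $ 1, p $ 2, p $ 3)\<close>; \<open>sphere 0 1\<close> in \<open>complex^2\<close> is \<open>S\<^sup>3\<close>.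
\<close>

definition graph_emb :: "(complex^2 \<Rightarrow> complex) \<Rightarrow> complex^2 \<Rightarrow> complex^3" where
  "graph_emb g q = vector [q $ 1, q $ 2, g q]"

definition graph_surface :: "(complex^2 \<Rightarrow> complex) \<Rightarrow> (complex^3) set" where
  "graph_surface g = graph_emb g ` sphere 0 1"

definition defining_map :: "(complex^2 \<Rightarrow> complex) \<Rightarrow> complex^3 \<Rightarrow> real^3" where
  "defining_map g p = vector
     [Re (p $ 3 - g (vector [p $ 1, p $ 2])),
      Im (p $ 3 - g (vector [p $ 1, p $ 2])),
      (cmod (p $ 1))\<^sup>2 + (cmod (p $ 2))\<^sup>2 - 1]"

lemma graph_surface_eq: "graph_surface g = {p. defining_map g p = 0}"
proof -
  have sphere: "q \<in> sphere 0 1 \<longleftrightarrow> (cmod (q $ 1))\<^sup>2 + (cmod (q $ 2))\<^sup>2 = 1" for q :: "complex^2"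
    by (simp add: norm_vec_def L2_set_def UNIV_2)
  have zero: "defining_map g p = 0 \<longleftrightarrow> p $ 3 = g (vector [p $ 1, p $ 2]) \<and>
      (cmod (p $ 1))\<^sup>2 + (cmod (p $ 2))\<^sup>2 = 1" for p
    by (auto simp: defining_map_def vec_eq_iff forall_3 complex_eq_iff)
  have eta: "vector [q $ 1, q $ 2] = q" for q :: "complex^2"
    by (simp add: vec_eq_iff forall_2)
  show ?thesis
  proof (intro set_eqI iffI)
    fix p assume "p \<in> graph_surface g"
    then obtain q where "q \<in> sphere 0 1" "p = graph_emb g q"
      by (auto simp: graph_surface_def)
    then show "p \<in> {p. defining_map g p = 0}"
      unfolding mem_Collect_eq zero sphere by (simp add: graph_emb_def eta)
  next
    fix p assume "p \<in> {p. defining_map g p = 0}"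
    then have "p = graph_emb g (vector [p $ 1, p $ 2])"
        and "vector [p $ 1, p $ 2] \<in> sphere (0 :: complex^2) 1"
      unfolding mem_Collect_eq zero sphere by (simp_all add: graph_emb_def vec_eq_iff forall_3)
    then show "p \<in> graph_surface g"
      unfolding graph_surface_def by (rule image_eqI)
  qed
qed

definition defining_fun :: "(complex^2 \<Rightarrow> complex) \<Rightarrow> 3 \<Rightarrow> complex^3 \<Rightarrow> complex" where
  "defining_fun g j p = complex_of_real (defining_map g p $ j)"

definition B_fun :: "(complex^2 \<Rightarrow> complex) \<Rightarrow> complex^3 \<Rightarrow> complex" where
  "B_fun g p = det (\<chi> j k. wirtinger k (defining_fun g j) p)"

text \<open>
  The real tangent space of an embedded submanifold, as the set of velocities at \<open>m\<close> of curves in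
  it. Only differentiability at time 0 is required of the curves; for an embedded \<open>C\<^sup>1\<close>
  submanifold this yields the same vectors as \<open>C\<^sup>1\<close> curves do.
\<close>

definition tangent_space :: "'a::real_normed_vector set \<Rightarrow> 'a \<Rightarrow> 'a set" where
  "tangent_space S m =
     {v. \<exists>c :: real \<Rightarrow> 'a. range c \<subseteq> S \<and> c 0 = m \<and> (c has_vector_derivative v) (at 0)}"

definition complex_line :: "(complex^'n::finite) set \<Rightarrow> bool" where
  "complex_line L \<longleftrightarrow> vec.subspace L \<and> vec.dim L = 1"

definition complex_tangent :: "(complex^'n::finite) set \<Rightarrow> complex^'n \<Rightarrow> bool" where
  "complex_tangent S m \<longleftrightarrow> m \<in> S \<and>
     complex_line (tangent_space S m \<inter> (\<lambda>v. \<i> *s v) ` tangent_space S m)"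

definition tangent_10 :: "(complex^2 \<Rightarrow> complex) \<Rightarrow> complex^3 \<Rightarrow> complex^3 \<Rightarrow> bool" where
  "tangent_10 g m \<xi> \<longleftrightarrow> \<xi> \<noteq> 0 \<and> (\<forall>j. vec_10 \<xi> (defining_fun g j) m = 0)"

text \<open>
  At a complex tangent \<open>m\<close> a vector \<open>\<xi>\<close> with \<open>tangent_10 g m \<xi>\<close> exists and is unique up to a nonzero
  complex factor, on which neither of the next two notions depends.
\<close>

definition nondegenerate :: "(complex^2 \<Rightarrow> complex) \<Rightarrow> complex^3 \<Rightarrow> bool" where
  "nondegenerate g m \<longleftrightarrow>
     (\<exists>\<xi>. tangent_10 g m \<xi> \<and> (vec_10 \<xi> (B_fun g) m \<noteq> 0 \<or> vec_01 \<xi> (B_fun g) m \<noteq> 0))"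

definition bishop_invariant :: "(complex^2 \<Rightarrow> complex) \<Rightarrow> complex^3 \<Rightarrow> ennreal" where
  "bishop_invariant g m = (THE c. \<exists>\<xi>. tangent_10 g m \<xi> \<and>
     c = (if vec_01 \<xi> (B_fun g) m = 0 then \<infinity>
          else ennreal (1 / 2 * cmod (vec_10 \<xi> (B_fun g) m / vec_01 \<xi> (B_fun g) m))))"

definition L_op :: "(complex^2 \<Rightarrow> complex) \<Rightarrow> complex^2 \<Rightarrow> complex" where
  "L_op f q = q $ 1 * wirtinger_bar 2 f q - q $ 2 * wirtinger_bar 1 f q"

definition Lbar_op :: "(complex^2 \<Rightarrow> complex) \<Rightarrow> complex^2 \<Rightarrow> complex" where
  "Lbar_op f q = cnj (q $ 1) * wirtinger 2 f q - cnj (q $ 2) * wirtinger 1 f q"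

end

theory Submission
  imports Defs
begin

text \<open>
  Writing \<open>\<zeta> - g = r\<^sub>1 + \<i> r\<^sub>2\<close>, the determinant expands to \<open>B = \<i>/2 \<cdot> cnj (\<L> g)\<close> on all of
  \<open>\<complex>\<^sup>3\<close>, constantly in \<open>\<zeta>\<close>. The equation \<open>X r\<^sub>3 = 0\<close> forces \<open>X = \<mu> cnj \<L>\<close> up to a
  \<open>\<partial>/\<partial>\<zeta>\<close> component determined by \<open>X r\<^sub>1 = X r\<^sub>2 = 0\<close>, so that \<open>X B = \<i>/2 \<cdot> \<mu> cnj (\<L> \<L> g)\<close> and
  \<open>cnj X B = \<i>/2 \<cdot> cnj \<mu> cnj (cnj \<L> \<L> g)\<close>; the scalar \<open>\<mu>\<close> disappears from the modulus of the quotient.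
\<close>

section \<open>Wirtinger derivatives in terms of the real derivative\<close>

lemma wirtinger_eq:
  assumes "(f has_derivative D) (at p)"
  shows "wirtinger k f p = (D (axis k 1) - \<i> * D (axis k \<i>)) / 2"
    and "wirtinger_bar k f p = (D (axis k 1) + \<i> * D (axis k \<i>)) / 2"
  using frechet_derivative_at[OF assms] by (simp_all add: wirtinger_def wirtinger_bar_def)

text \<open>The real-linear \<open>D\<close> is the sum of a complex-linear and an antilinear map. A
  (1,0) vector sees only the first, which the values of \<open>D\<close> at \<open>\<xi>\<close> and
  \<open>\<i> *s \<xi>\<close> isolate.\<close>

lemma vec_10_eq:
  assumes D: "(f has_derivative D) (at p)"
  shows "vec_10 \<xi> f p = (D \<xi> - \<i> * D (\<i> *s \<xi>)) / 2"
proof -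
  interpret D: linear D using D by (rule has_derivative_linear)
  have expand: "D v = (\<Sum>k\<in>UNIV. of_real (Re (v $ k)) * D (axis k 1)
                       + of_real (Im (v $ k)) * D (axis k \<i>))" for v
  proof -
    \<comment> \<open>\<open>D\<close> is only real-linear, so \<open>v\<close> is split along the
      real basis \<open>axis k 1\<close>, \<open>axis k \<i>\<close>.\<close>
    have "v = (\<Sum>k\<in>UNIV. Re (v $ k) *\<^sub>R axis k 1 + Im (v $ k) *\<^sub>R axis k \<i>)"
      by (simp add: vec_eq_iff axis_def if_distrib[where f = "\<lambda>x. _ *\<^sub>R x"] sum.distrib complex_eq_iff
          cong: if_cong)
    then have "D v = D (\<Sum>k\<in>UNIV. Re (v $ k) *\<^sub>R axis k 1 + Im (v $ k) *\<^sub>R axis k \<i>)"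
      by (rule arg_cong)
    then show ?thesis by (simp only: D.sum D.add D.scale) (simp add: scaleR_conv_of_real)
  qed
  show ?thesis
    unfolding expand[of \<xi>] expand[of "\<i> *s \<xi>"] vec_10_def wirtinger_eq[OF D]
      sum_distrib_left sum_subtractf[symmetric] sum_divide_distrib
    by (rule sum.cong) (simp_all add: complex_eq_iff field_simps)
qed

section \<open>Tangent vectors and complex lines\<close>

lemma derivative_tangent_space_eq_0:
  fixes f :: "'a::real_normed_vector \<Rightarrow> 'b::real_normed_vector"
  assumes D: "(f has_derivative D) (at m)"
    and S: "\<And>x. x \<in> S \<Longrightarrow> f x = 0"
    and v: "v \<in> tangent_space S m"
  shows "D v = 0"
proof -
  obtain c where c: "range c \<subseteq> S" "c 0 = m" "(c has_vector_derivative v) (at 0)"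
    using v by (auto simp: tangent_space_def)
  \<comment> \<open>By the chain rule \<open>f \<circ> c\<close> has velocity \<open>D v\<close> at
    time 0, while it is constantly 0 because \<open>c\<close> stays in \<open>S\<close>.\<close>
  have "((f \<circ> c) has_derivative D \<circ> (\<lambda>h. h *\<^sub>R v)) (at 0)"
    using c D by (intro diff_chain_at) (auto simp: has_vector_derivative_def)
  moreover have "f \<circ> c = (\<lambda>_. 0)" using c S by (auto simp: fun_eq_iff subset_iff)
  ultimately have "D \<circ> (\<lambda>h. h *\<^sub>R v) = (\<lambda>_. 0)"
    using has_derivative_unique has_derivative_const by metis
  then show ?thesis by (metis comp_apply scaleR_one)
qed

text \<open>A set inside \<open>{0}\<close> lies in the span of the empty set, so its dimension is 0
  and not 1.\<close>

lemma complex_line_nonzero: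
  assumes "complex_line L"
  obtains v where "v \<in> L" "v \<noteq> 0"
proof -
  have "\<not> L \<subseteq> {0}"
  proof
    assume "L \<subseteq> {0}"
    then have "vec.dim L \<le> card ({} :: (complex^'a) set)"
      by (simp add: vec.dim_le_card[of _ "{}"])
    then show False using assms unfolding complex_line_def card.empty by linarith
  qed
  then show ?thesis using that by blast
qed

section \<open>Derivatives of the defining functions and the determinant B\<close>

definition proj12 :: "complex^3 \<Rightarrow> complex^2" where
  "proj12 p = vector [p $ 1, p $ 2]"

lemma proj12_nth [simp]: "proj12 p $ 1 = p $ 1" "proj12 p $ 2 = p $ 2"
  by (simp_all add: proj12_def)

lemma proj12_graph_emb [simp]: "proj12 (graph_emb g q) = q"
  by (simp add: vec_eq_iff forall_2 graph_emb_def)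

lemma bounded_linear_proj12: "bounded_linear proj12"
  by (intro linear_conv_bounded_linear[THEN iffD1] linearI)
     (simp_all add: vec_eq_iff forall_2)

lemma proj12_axis [simp]:
  "proj12 (axis 1 x) = axis 1 x" "proj12 (axis 2 x) = axis 2 x" "proj12 (axis 3 x) = 0"
  by (simp_all add: vec_eq_iff forall_2 axis_def)

lemma has_derivative_comp_proj12:
  assumes "(f has_derivative D) (at (proj12 p))"
  shows "((\<lambda>x. f (proj12 x)) has_derivative (\<lambda>h. D (proj12 h))) (at p)"
  using has_derivative_compose[OF bounded_linear_imp_has_derivative[OF bounded_linear_proj12] assms] .

lemma defining_fun_has_derivative:
  assumes g: "(g has_derivative D) (at (proj12 p))"
  shows "(defining_fun g 1 has_derivative (\<lambda>h. of_real (Re (h $ 3 - D (proj12 h))))) (at p)"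
    and "(defining_fun g 2 has_derivative (\<lambda>h. of_real (Im (h $ 3 - D (proj12 h))))) (at p)"
    and "(defining_fun g 3 has_derivative
           (\<lambda>h. of_real (2 * Re (cnj (p $ 1) * h $ 1 + cnj (p $ 2) * h $ 2)))) (at p)"
proof -
  note g' = has_derivative_comp_proj12[OF g]
  have nth: "((\<lambda>x. x $ k) has_derivative (\<lambda>h. h $ k)) (at p)" for k :: 3
    by (rule bounded_linear_imp_has_derivative) (rule bounded_linear_vec_nth)
  have sq: "((\<lambda>x. (Re (x $ k))\<^sup>2) has_derivative (\<lambda>h. 2 * Re (p $ k) * Re (h $ k))) (at p)"
    "((\<lambda>x. (Im (x $ k))\<^sup>2) has_derivative (\<lambda>h. 2 * Im (p $ k) * Im (h $ k))) (at p)" for k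
    by (rule has_derivative_eq_rhs[OF has_derivative_power], rule has_derivative_Re has_derivative_Im,
        rule nth, simp add: fun_eq_iff)+
  \<comment> \<open>Squared moduli are written out in real coordinates because \<open>cmod\<close>
    itself is not differentiable at 0, and z or w may vanish.\<close>
  have eq: "defining_fun g 1 = (\<lambda>p. of_real (Re (p $ 3 - g (proj12 p))))"
    "defining_fun g 2 = (\<lambda>p. of_real (Im (p $ 3 - g (proj12 p))))"
    "defining_fun g 3 = (\<lambda>p. of_real ((Re (p $ 1))\<^sup>2 + (Im (p $ 1))\<^sup>2 + ((Re (p $ 2))\<^sup>2 + (Im (p $ 2))\<^sup>2) - 1))"
    by (simp_all add: fun_eq_iff defining_fun_def defining_map_def proj12_def cmod_power2)
  show "(defining_fun g 1 has_derivative (\<lambda>h. of_real (Re (h $ 3 - D (proj12 h))))) (at p)"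
    "(defining_fun g 2 has_derivative (\<lambda>h. of_real (Im (h $ 3 - D (proj12 h))))) (at p)"
    unfolding eq by (intro has_derivative_of_real has_derivative_Re has_derivative_Im has_derivative_diff nth g')+
  show "(defining_fun g 3 has_derivative
      (\<lambda>h. of_real (2 * Re (cnj (p $ 1) * h $ 1 + cnj (p $ 2) * h $ 2)))) (at p)"
    unfolding eq
    by (rule has_derivative_eq_rhs,
        (rule has_derivative_of_real has_derivative_diff has_derivative_add sq has_derivative_const)+)
      (simp add: fun_eq_iff algebra_simps)
qed

lemma axis_nth_eq: "axis i x $ j = (if j = i then x else 0)"
  by (simp add: axis_def)

text \<open>Since r_1 + i r_2 = \<zeta> - g and r_1 - i r_2 is its conjugate, complex linearity
  reduces these combinations to derivatives of g and of \<open>cnj\<close> g; conjugation exchanges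
  the two kinds of Wirtinger derivative. The last two values come from writing Re \<zeta> and Im
  \<zeta> in terms of \<zeta> and its conjugate.\<close>

lemma wirtinger_defining_fun:
  assumes g: "g differentiable (at (proj12 p))"
  shows "wirtinger 1 (defining_fun g 3) p = cnj (p $ 1)"
    and "wirtinger 2 (defining_fun g 3) p = cnj (p $ 2)"
    and "wirtinger 3 (defining_fun g 3) p = 0"
    and "wirtinger 1 (defining_fun g 1) p + \<i> * wirtinger 1 (defining_fun g 2) p
           = - wirtinger 1 g (proj12 p)"
    and "wirtinger 2 (defining_fun g 1) p + \<i> * wirtinger 2 (defining_fun g 2) p
           = - wirtinger 2 g (proj12 p)"
    and "wirtinger 1 (defining_fun g 1) p - \<i> * wirtinger 1 (defining_fun g 2) p
           = - cnj (wirtinger_bar 1 g (proj12 p))"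
    and "wirtinger 2 (defining_fun g 1) p - \<i> * wirtinger 2 (defining_fun g 2) p
           = - cnj (wirtinger_bar 2 g (proj12 p))"
    and "wirtinger 3 (defining_fun g 1) p = 1 / 2"
    and "wirtinger 3 (defining_fun g 2) p = - \<i> / 2"
proof -
  obtain D where D: "(g has_derivative D) (at (proj12 p))"
    using g by (auto simp: differentiable_def)
  have D0: "D 0 = 0" using D has_derivative_linear linear_0 by blast
  note w = wirtinger_eq[OF D] defining_fun_has_derivative[OF D, THEN wirtinger_eq(1)]
  show "wirtinger 1 (defining_fun g 3) p = cnj (p $ 1)"
    "wirtinger 2 (defining_fun g 3) p = cnj (p $ 2)"
    "wirtinger 3 (defining_fun g 3) p = 0"
    "wirtinger 1 (defining_fun g 1) p + \<i> * wirtinger 1 (defining_fun g 2) p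
           = - wirtinger 1 g (proj12 p)"
    "wirtinger 2 (defining_fun g 1) p + \<i> * wirtinger 2 (defining_fun g 2) p
           = - wirtinger 2 g (proj12 p)"
    "wirtinger 1 (defining_fun g 1) p - \<i> * wirtinger 1 (defining_fun g 2) p
           = - cnj (wirtinger_bar 1 g (proj12 p))"
    "wirtinger 2 (defining_fun g 1) p - \<i> * wirtinger 2 (defining_fun g 2) p
           = - cnj (wirtinger_bar 2 g (proj12 p))"
    "wirtinger 3 (defining_fun g 1) p = 1 / 2"
    "wirtinger 3 (defining_fun g 2) p = - \<i> / 2"
    unfolding w by (simp_all add: D0 axis_nth_eq complex_eq_iff field_simps)
qed

lemma B_fun_eq:
  assumes g: "g differentiable (at (proj12 p))"
  shows "B_fun g p = \<i> / 2 * cnj (L_op g (proj12 p))"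
proof -
  note w = wirtinger_defining_fun[OF g]
  let ?r = "\<lambda>j k. wirtinger k (defining_fun g j) p"
  \<comment> \<open>Expanding along the third column, with entries 1/2, -i/2, 0, merges the first
    two rows into r_1 - i r_2, so only \<open>wirtinger_bar\<close> of g enters.\<close>
  have "B_fun g p = \<i> / 2 * (cnj (p $ 2) * (?r 1 1 - \<i> * ?r 2 1) - cnj (p $ 1) * (?r 1 2 - \<i> * ?r 2 2))"
    unfolding B_fun_def det_3 by (simp add: w(1-3,8,9)) (simp add: algebra_simps)
  then show ?thesis unfolding w by (simp add: L_op_def algebra_simps)
qed

text \<open>This is the shape of \<open>B_fun g\<close>, with \<open>L_op g\<close> as
  \<open>f\<close>. Constancy in \<zeta> gives the zeros, so the third component of \<xi> does not
  contribute to XB.\<close>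

lemma wirtinger_comp_proj12:
  assumes f: "f differentiable (at (proj12 p))"
  shows "wirtinger 1 (\<lambda>x. a * cnj (f (proj12 x))) p = a * cnj (wirtinger_bar 1 f (proj12 p))"
    and "wirtinger 2 (\<lambda>x. a * cnj (f (proj12 x))) p = a * cnj (wirtinger_bar 2 f (proj12 p))"
    and "wirtinger 3 (\<lambda>x. a * cnj (f (proj12 x))) p = 0"
    and "wirtinger_bar 1 (\<lambda>x. a * cnj (f (proj12 x))) p = a * cnj (wirtinger 1 f (proj12 p))"
    and "wirtinger_bar 2 (\<lambda>x. a * cnj (f (proj12 x))) p = a * cnj (wirtinger 2 f (proj12 p))"
    and "wirtinger_bar 3 (\<lambda>x. a * cnj (f (proj12 x))) p = 0"
proof -
  obtain D where D: "(f has_derivative D) (at (proj12 p))"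
    using f by (auto simp: differentiable_def)
  have D0: "D 0 = 0" using D has_derivative_linear linear_0 by blast
  have "((\<lambda>x. a * cnj (f (proj12 x))) has_derivative (\<lambda>h. a * cnj (D (proj12 h)))) (at p)"
    by (intro has_derivative_mult_right has_derivative_cnj has_derivative_comp_proj12 D)
  note w = wirtinger_eq[OF this] wirtinger_eq[OF D]
  show "wirtinger 1 (\<lambda>x. a * cnj (f (proj12 x))) p = a * cnj (wirtinger_bar 1 f (proj12 p))"
    "wirtinger 2 (\<lambda>x. a * cnj (f (proj12 x))) p = a * cnj (wirtinger_bar 2 f (proj12 p))"
    "wirtinger 3 (\<lambda>x. a * cnj (f (proj12 x))) p = 0"
    "wirtinger_bar 1 (\<lambda>x. a * cnj (f (proj12 x))) p = a * cnj (wirtinger 1 f (proj12 p))"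
    "wirtinger_bar 2 (\<lambda>x. a * cnj (f (proj12 x))) p = a * cnj (wirtinger 2 f (proj12 p))"
    "wirtinger_bar 3 (\<lambda>x. a * cnj (f (proj12 x))) p = 0"
    unfolding w by (simp_all add: D0 algebra_simps)
qed

section \<open>Differentiability of g and of its first-order derivatives\<close>

lemma C2_differentiable: "C2 g \<Longrightarrow> g differentiable (at x)"
  unfolding C2_def differentiable_def by blast

text \<open>Evaluating the differentiable operator-valued map \<open>g'\<close> at a fixed vector is
  bounded linear, so each directional derivative of g is differentiable.\<close>

lemma C2_L_op_differentiable:
  assumes "C2 g"
  shows "L_op g differentiable (at x)"
proof -
  obtain g' g'' where g': "\<And>x. (g has_derivative blinfun_apply (g' x)) (at x)"
    and g'': "\<And>x. (g' has_derivative blinfun_apply (g'' x)) (at x)"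
    using assms unfolding C2_def by blast
  have 1: "(\<lambda>x. blinfun_apply (g' x) v) differentiable (at x)" for v
    using bounded_linear.has_derivative[OF blinfun.bounded_linear_left g'']
    by (auto simp: differentiable_def)
  have 2: "(\<lambda>x. x $ k) differentiable (at x)" for k :: 2
    by (rule bounded_linear_imp_differentiable) (rule bounded_linear_vec_nth)
  have "L_op g = (\<lambda>x. x $ 1 * ((blinfun_apply (g' x) (axis 2 1) + \<i> * blinfun_apply (g' x) (axis 2 \<i>)) * (1/2))
                    - x $ 2 * ((blinfun_apply (g' x) (axis 1 1) + \<i> * blinfun_apply (g' x) (axis 1 \<i>)) * (1/2)))"
    by (simp add: L_op_def fun_eq_iff wirtinger_eq[OF g'])
  then show ?thesis
    by (simp add: 1 2)
qed

section \<open>The (1,0) vectors at a complex tangent\<close>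

lemma tangent_10_scalar:
  assumes g: "g differentiable (at q)" and q: "q \<noteq> 0"
    and t: "tangent_10 g (graph_emb g q) \<xi>"
  obtains \<mu> where "\<mu> \<noteq> 0" "\<xi> $ 1 = - \<mu> * cnj (q $ 2)" "\<xi> $ 2 = \<mu> * cnj (q $ 1)"
proof -
  let ?p = "graph_emb g q"
  have p [simp]: "?p $ 1 = q $ 1" "?p $ 2 = q $ 2" by (simp_all add: graph_emb_def)
  have "g differentiable (at (proj12 ?p))" using g by simp
  note w = wirtinger_defining_fun[OF this]
  have t: "\<xi> \<noteq> 0" "\<And>j. vec_10 \<xi> (defining_fun g j) ?p = 0"
    using t by (auto simp: tangent_10_def)
  \<comment> \<open>X r_3 = 0 is one linear equation with coefficients not both zero; its solutions
    are the multiples of (-\<open>cnj\<close> w, \<open>cnj\<close> z).\<close>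
  have 3: "\<xi> $ 1 * cnj (q $ 1) + \<xi> $ 2 * cnj (q $ 2) = 0"
    using t(2)[of 3] by (simp add: vec_10_def sum_3 w)
  \<comment> \<open>X(\<zeta> - g) = 0 expresses \<open>\<xi> $ 3\<close> through the other two
    components, which therefore cannot both vanish; this yields
    \<open>\<mu> \<noteq> 0\<close>.\<close>
  have "vec_10 \<xi> (defining_fun g 1) ?p + \<i> * vec_10 \<xi> (defining_fun g 2) ?p
      = \<xi> $ 1 * (wirtinger 1 (defining_fun g 1) ?p + \<i> * wirtinger 1 (defining_fun g 2) ?p)
      + \<xi> $ 2 * (wirtinger 2 (defining_fun g 1) ?p + \<i> * wirtinger 2 (defining_fun g 2) ?p)
      + \<xi> $ 3 * (wirtinger 3 (defining_fun g 1) ?p + \<i> * wirtinger 3 (defining_fun g 2) ?p)"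
    by (simp add: vec_10_def sum_3 algebra_simps)
  then have \<xi>3: "\<xi> $ 3 = \<xi> $ 1 * wirtinger 1 g q + \<xi> $ 2 * wirtinger 2 g q"
    unfolding w by (simp add: t(2) w algebra_simps)
  have ne: "\<xi> $ 1 \<noteq> 0 \<or> \<xi> $ 2 \<noteq> 0"
    using t(1) \<xi>3 by (auto simp: vec_eq_iff forall_3)
  show ?thesis
  proof (cases "q $ 1 = 0")
    case True
    then have "q $ 2 \<noteq> 0" using q by (auto simp: vec_eq_iff forall_2)
    then show ?thesis using True 3 ne
      by (intro that[of "- \<xi> $ 1 / cnj (q $ 2)"]) auto
  next
    case False
    then have "\<xi> $ 1 = - (\<xi> $ 2 / cnj (q $ 1)) * cnj (q $ 2)"
      using 3 by (simp add: field_simps eq_neg_iff_add_eq_0)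
    then show ?thesis using False ne
      by (intro that[of "\<xi> $ 2 / cnj (q $ 1)"]) auto
  qed
qed

text \<open>A nonzero \<open>v\<close> on the complex line serves as \<open>\<xi>\<close>: the real
  derivative of each r_j vanishes on \<open>v\<close> and on \<open>\<i> *s v\<close>, and
  \<open>vec_10_eq\<close> turns this into X r_j = 0.\<close>

lemma complex_tangent_tangent_10:
  assumes g: "g differentiable (at q)"
    and ct: "complex_tangent (graph_surface g) (graph_emb g q)"
  obtains \<xi> where "tangent_10 g (graph_emb g q) \<xi>"
proof -
  let ?p = "graph_emb g q" and ?T = "tangent_space (graph_surface g) (graph_emb g q)"
  have "complex_line (?T \<inter> (\<lambda>v. \<i> *s v) ` ?T)"
    using ct by (simp add: complex_tangent_def)
  then obtain v where v: "v \<in> ?T" "v \<noteq> 0" "v \<in> (\<lambda>v. \<i> *s v) ` ?T"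
    by (rule complex_line_nonzero) blast
  then obtain u where u: "u \<in> ?T" "v = \<i> *s u" by blast
  have "vec_10 v (defining_fun g j) ?p = 0" for j
  proof -
    obtain D where "(g has_derivative D) (at (proj12 ?p))"
      using g by (auto simp: differentiable_def)
    note d = defining_fun_has_derivative[OF this]
    obtain E where E: "(defining_fun g j has_derivative E) (at ?p)"
      using d exhaust_3[of j] by blast
    have "defining_fun g j x = 0" if "x \<in> graph_surface g" for x
      using that by (simp add: graph_surface_eq defining_fun_def)
    then have "E v = 0" "E u = 0"
      using derivative_tangent_space_eq_0[OF E] v u by blast+
    moreover have "\<i> *s v = - u" using u by (simp add: vec_eq_iff)
    moreover have "E (- u) = - E u"
      using E has_derivative_linear linear_neg by blast
    ultimately show ?thesis by (simp add: vec_10_eq[OF E])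
  qed
  then show ?thesis using v that by (auto simp: tangent_10_def)
qed

theorem theorem1:
  fixes g :: "complex^2 \<Rightarrow> complex" and q :: "complex^2"
  assumes "C2 g"
    and "q \<in> sphere 0 1"
    and "complex_tangent (graph_surface g) (graph_emb g q)"
  shows "(\<not> nondegenerate g (graph_emb g q) \<longleftrightarrow>
            L_op (L_op g) q = 0 \<and> Lbar_op (L_op g) q = 0) \<and>
         (nondegenerate g (graph_emb g q) \<longrightarrow>
            bishop_invariant g (graph_emb g q) =
              (if Lbar_op (L_op g) q = 0 then \<infinity>
               else ennreal (1 / 2 * (cmod (L_op (L_op g) q) / cmod (Lbar_op (L_op g) q)))))"
proof -
  let ?p = "graph_emb g q" and ?F = "L_op g"
  note g = C2_differentiable[OF assms(1)]
  have q: "q \<noteq> 0" using assms(2) by auto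
  obtain \<xi>\<^sub>0 where \<xi>\<^sub>0: "tangent_10 g ?p \<xi>\<^sub>0"
    using complex_tangent_tangent_10[OF g assms(3)] by blast
  \<comment> \<open>The identity holds on all of \<complex>^3, so it may be differentiated in
    directions leaving the surface.\<close>
  have B: "B_fun g = (\<lambda>p. \<i> / 2 * cnj (?F (proj12 p)))"
    using B_fun_eq[OF g] by (rule ext)
  have XB: "\<exists>\<mu>. \<mu> \<noteq> 0 \<and> vec_10 \<xi> (B_fun g) ?p = \<i> / 2 * \<mu> * cnj (L_op ?F q) \<and>
      vec_01 \<xi> (B_fun g) ?p = \<i> / 2 * cnj \<mu> * cnj (Lbar_op ?F q)"
    if t: "tangent_10 g ?p \<xi>" for \<xi>
  proof -
    obtain \<mu> where \<mu>: "\<mu> \<noteq> 0" "\<xi> $ 1 = - \<mu> * cnj (q $ 2)" "\<xi> $ 2 = \<mu> * cnj (q $ 1)"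
      using tangent_10_scalar[OF g q t] by blast
    note w = wirtinger_comp_proj12[OF C2_L_op_differentiable, OF assms(1), where p = ?p and a = "\<i> / 2", unfolded proj12_graph_emb]
    have "vec_10 \<xi> (B_fun g) ?p = \<i> / 2 * \<mu> * cnj (L_op ?F q)"
      unfolding vec_10_def sum_3 B w \<mu> L_op_def[of "L_op g"] by (simp add: algebra_simps)
    moreover have "vec_01 \<xi> (B_fun g) ?p = \<i> / 2 * cnj \<mu> * cnj (Lbar_op ?F q)"
      unfolding vec_01_def sum_3 B w \<mu> Lbar_op_def by (simp add: algebra_simps)
    ultimately show ?thesis using \<mu>(1) by blast
  qed
  \<comment> \<open>\<open>\<mu>\<close> and \<open>cnj \<mu>\<close> are nonzero of equal modulus,
    so none of these facts depends on the choice of \<open>\<xi>\<close>.\<close>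
  have zero: "vec_10 \<xi> (B_fun g) ?p = 0 \<longleftrightarrow> L_op ?F q = 0"
    "vec_01 \<xi> (B_fun g) ?p = 0 \<longleftrightarrow> Lbar_op ?F q = 0"
    "cmod (vec_10 \<xi> (B_fun g) ?p / vec_01 \<xi> (B_fun g) ?p) = cmod (L_op ?F q) / cmod (Lbar_op ?F q)"
    if "tangent_10 g ?p \<xi>" for \<xi>
  proof -
    obtain \<mu> where \<mu>: "\<mu> \<noteq> 0" "vec_10 \<xi> (B_fun g) ?p = \<i> / 2 * \<mu> * cnj (L_op ?F q)"
      "vec_01 \<xi> (B_fun g) ?p = \<i> / 2 * cnj \<mu> * cnj (Lbar_op ?F q)"
      using XB[OF \<open>tangent_10 g ?p \<xi>\<close>] by blast
    show "vec_10 \<xi> (B_fun g) ?p = 0 \<longleftrightarrow> L_op ?F q = 0"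
      "vec_01 \<xi> (B_fun g) ?p = 0 \<longleftrightarrow> Lbar_op ?F q = 0"
      unfolding \<mu> by (simp_all add: \<mu>(1))
    show "cmod (vec_10 \<xi> (B_fun g) ?p / vec_01 \<xi> (B_fun g) ?p) = cmod (L_op ?F q) / cmod (Lbar_op ?F q)"
      unfolding \<mu> by (simp add: \<mu>(1) norm_mult norm_divide)
  qed
  have "nondegenerate g ?p \<longleftrightarrow> L_op ?F q \<noteq> 0 \<or> Lbar_op ?F q \<noteq> 0"
    unfolding nondegenerate_def using zero \<xi>\<^sub>0 by blast
  \<comment> \<open>\<open>\<xi>\<^sub>0\<close> shows that the described value exists, and
    \<open>zero\<close>, valid for every \<open>\<xi>\<close>, shows that it is unique.\<close>
  moreover have "bishop_invariant g ?p = (if Lbar_op ?F q = 0 then \<infinity>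
               else ennreal (1 / 2 * (cmod (L_op ?F q) / cmod (Lbar_op ?F q))))"
    unfolding bishop_invariant_def
    by (rule the_equality) (use \<xi>\<^sub>0 zero in \<open>auto intro!: exI[of _ \<xi>\<^sub>0]\<close>)
  ultimately show ?thesis by blast
qed

end
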